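(* Let $\mathcal{P}(x,c)=c^t m$ be a parametric polynomial with parameter vector $c$, where $m$ is the vector of monomials $x^I$, $I\le\delta$, in $x=(x_1,\dots,x_n)$. Let $\mathcal{B}$ be the matrix converting monomials to the Bernstein basis, and let $Az\le b$ be the constraint system of one of the three Bernstein linear programming relaxations, all as defined in the context. Then a parameter vector $c$ satisfies $$(\forall z)\quad Az\le b\ \Rightarrow\ c^t\mathcal{B}z\ge 0$$ if and only if there exists a vector of multipliers $\lambda\ge0$ such that $$A^t\lambda=-\mathcal{B}^tc\quad\text{and}\quad b^t\lambda\le0.$$
   Context: Multi-index notation: for $I,J\in\mathbb{N}^n$, $I\le J$ means $i_l\le j_l$ for all $l$; $J<\delta$ means $J\le\delta$, $J\ne\delta$; $\binom{I}{J}=\prod_l\binom{i_l}{j_l}$; $I/J$ is the componentwise quotient (with $0/0$ read as $0$); $I_{r,k}$ is $I$ with its $r$-th component increased by $k$. Vector inequalities are componentwise. For $\delta\in\mathbb{N}^n$, $I\le\delta$, the Bernstein polynomial is $B_{I,\delta}(x)=\prod_{l=1}^n\binom{\delta_l}{i_l}x_l^{i_l}(1-x_l)^{\delta_l-i_l}$. Every monomial $x^I$ with $I\le\delta$ has a Bernstein expansion $x^I=\sum_{J\le\delta}b_{J,I}B_{J,\delta}$, where $b_{J,I}=\binom{J}{I}/\binom{\delta}{I}$ if $I\le J$ and $0$ otherwise. The vector $z$ collects real variables that are placeholders for Bernstein polynomials. The matrix $\mathcal{B}$ has one row for each monomial $x^I$, $I\le\delta$, and one column for each component of $z$; the entry in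 row $I$ and the column of $z_{J,\delta}$ is $b_{J,I}$, and columns of any additional variables $z_{J,\delta'}$ with $\delta'<\delta$ are zero. The system $Az\le b$ encodes (each equality being written as two inequalities) the constraints of one of the following: (LP1) variables $z_{I,\delta}$, $I\le\delta$: $z_{I,\delta}\ge0$ for all $I\le\delta$, and $\sum_{I\le\delta}z_{I,\delta}=1$. (LP2) variables $z_{I,\delta}$, $I\le\delta$: $0\le z_{I,\delta}\le B_{I,\delta}(I/\delta)$ for all $I\le\delta$, and $\sum_{I\le\delta}z_{I,\delta}=1$. (LP3) variables $z_{J,\delta'}$ for all $\delta'\le\delta$ and $J\le\delta'$: $0\le z_{J,\delta'}\le B_{J,\delta'}(J/\delta')$; $\sum_{J\le\delta'}z_{J,\delta'}=1$ for all $\delta'\le\delta$; and for every $\delta'<\delta$, every $r$ with $\delta'_{r,1}\le\delta$ and every $J\le\delta'$, $z_{J,\delta'}=\frac{\delta'_r+1-j_r}{\delta'_r+1}z_{J,\delta'_{r,1}}+\frac{j_r+1}{\delta'_r+1}z_{J_{r,1},\delta'_{r,1}}$, where $\delta'_r$ is the $r$-th component of $\delta'$. *)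

theory Defs
  imports "HOL-Analysis.Analysis"
begin

text \<open>Multi-indices are functions \<open>'n \<Rightarrow> nat\<close> over a finite type of coordinates. The pointwise
  order on functions is the componentwise order, and \<open><\<close> on functions is ``\<open>\<le>\<close> and \<open>\<noteq>\<close>''.\<close>

type_synonym 'n mindex = "'n \<Rightarrow> nat"

definition mbinomial :: "'n::finite mindex \<Rightarrow> 'n mindex \<Rightarrow> nat" where
  "mbinomial I J = (\<Prod>l\<in>UNIV. I l choose J l)"

definition monomial :: "'n::finite mindex \<Rightarrow> real ^ 'n \<Rightarrow> real" where
  "monomial I x = (\<Prod>l\<in>UNIV. x $ l ^ I l)"

definition mBernstein :: "'n::finite mindex \<Rightarrow> 'n mindex \<Rightarrow> real ^ 'n \<Rightarrow> real" where
  "mBernstein I \<delta> x = (\<Prod>l\<in>UNIV. Bernstein (\<delta> l) (I l) (x $ l))"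

text \<open>The convention \<open>0 / 0 = 0\<close> is that of division in HOL.\<close>

definition mquot :: "'n::finite mindex \<Rightarrow> 'n mindex \<Rightarrow> real ^ 'n" where
  "mquot I J = (\<chi> l. real (I l) / real (J l))"

definition mshift :: "'n mindex \<Rightarrow> 'n \<Rightarrow> nat \<Rightarrow> 'n mindex" where
  "mshift I r k = I(r := I r + k)"


text \<open>The variable \<open>z\<^bsub>J,\<delta>'\<^esub>\<close> is indexed by the pair \<open>(J, \<delta>')\<close>.\<close>

type_synonym 'n bvar = "'n mindex \<times> 'n mindex"

definition bern_coeff :: "'n::finite mindex \<Rightarrow> 'n mindex \<Rightarrow> 'n mindex \<Rightarrow> real" where
  "bern_coeff \<delta> J I = (if I \<le> J then real (mbinomial J I) / real (mbinomial \<delta> I) else 0)"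

definition bern_mat :: "'n::finite mindex \<Rightarrow> 'n mindex \<Rightarrow> 'n bvar \<Rightarrow> real" where
  "bern_mat \<delta> I = (\<lambda>(J, \<delta>'). if \<delta>' = \<delta> then bern_coeff \<delta> J I else 0)"


datatype relaxation = LP1 | LP2 | LP3

definition lp_vars :: "relaxation \<Rightarrow> 'n mindex \<Rightarrow> 'n bvar set" where
  "lp_vars lp \<delta> =
    (if lp = LP3 then {(J, \<delta>'). \<delta>' \<le> \<delta> \<and> J \<le> \<delta>'} else {(J, \<delta>'). \<delta>' = \<delta> \<and> J \<le> \<delta>})"

text \<open>Row labels of the system \<open>A z \<le> b\<close>; an equality contributes its \<open>Le\<close> row and its \<open>Ge\<close> row
  (the latter being the former with both sides negated).\<close>

datatype 'n lp_row =
    Nonneg "'n mindex" "'n mindex"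
  | Upper "'n mindex" "'n mindex"
  | SumLe "'n mindex"
  | SumGe "'n mindex"
  | RecLe "'n mindex" "'n mindex" 'n
  | RecGe "'n mindex" "'n mindex" 'n

definition lp_rows :: "relaxation \<Rightarrow> 'n mindex \<Rightarrow> 'n lp_row set" where
  "lp_rows lp \<delta> =
     {Nonneg J \<delta>' |J \<delta>'. (J, \<delta>') \<in> lp_vars lp \<delta>}
   \<union> (if lp = LP1 then {} else {Upper J \<delta>' |J \<delta>'. (J, \<delta>') \<in> lp_vars lp \<delta>})
   \<union> (let D = (if lp = LP3 then {\<delta>'. \<delta>' \<le> \<delta>} else {\<delta>}) in SumLe ` D \<union> SumGe ` D)
   \<union> (if lp = LP3
      then (\<Union>(\<delta>', r, J) \<in> {(\<delta>', r, J). \<delta>' < \<delta> \<and> mshift \<delta>' r 1 \<le> \<delta> \<and> J \<le> \<delta>'}.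
              {RecLe J \<delta>' r, RecGe J \<delta>' r})
      else {})"

definition rec_entry :: "'n mindex \<Rightarrow> 'n mindex \<Rightarrow> 'n \<Rightarrow> 'n bvar \<Rightarrow> real" where
  "rec_entry J \<delta>' r v =
     of_bool (v = (J, \<delta>'))
     - (real (\<delta>' r) + 1 - real (J r)) / (real (\<delta>' r) + 1) * of_bool (v = (J, mshift \<delta>' r 1))
     - (real (J r) + 1) / (real (\<delta>' r) + 1) * of_bool (v = (mshift J r 1, mshift \<delta>' r 1))"

fun lp_mat :: "'n lp_row \<Rightarrow> 'n bvar \<Rightarrow> real" where
  "lp_mat (Nonneg J \<delta>') v = - of_bool (v = (J, \<delta>'))"
| "lp_mat (Upper J \<delta>') v = of_bool (v = (J, \<delta>'))"
| "lp_mat (SumLe \<delta>') v = of_bool (snd v = \<delta>')"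
| "lp_mat (SumGe \<delta>') v = - of_bool (snd v = \<delta>')"
| "lp_mat (RecLe J \<delta>' r) v = rec_entry J \<delta>' r v"
| "lp_mat (RecGe J \<delta>' r) v = - rec_entry J \<delta>' r v"

fun lp_rhs :: "'n::finite lp_row \<Rightarrow> real" where
  "lp_rhs (Nonneg J \<delta>') = 0"
| "lp_rhs (Upper J \<delta>') = mBernstein J \<delta>' (mquot J \<delta>')"
| "lp_rhs (SumLe \<delta>') = 1"
| "lp_rhs (SumGe \<delta>') = - 1"
| "lp_rhs (RecLe J \<delta>' r) = 0"
| "lp_rhs (RecGe J \<delta>' r) = 0"


lemma mindex_atMost_PiE: "{..\<delta>} = PiE UNIV (\<lambda>l. {..\<delta> l})" for \<delta> :: "'n mindex"
  by (auto simp: le_fun_def PiE_def Pi_def extensional_def)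

lemma finite_mindex_le: "finite {J. J \<le> \<delta>}" for \<delta> :: "'n::finite mindex"
  using mindex_atMost_PiE[of \<delta>] by (metis atMost_def finite_PiE finite_atMost finite)

lemma finite_lp_vars: "finite (lp_vars lp \<delta>)" for \<delta> :: "'n::finite mindex"
proof (rule finite_subset)
  show "lp_vars lp \<delta> \<subseteq> {J. J \<le> \<delta>} \<times> {J. J \<le> \<delta>}"
    by (auto simp: lp_vars_def split: if_splits intro: order_trans)
qed (simp add: finite_mindex_le)

lemma finite_lp_rows: "finite (lp_rows lp \<delta>)" for \<delta> :: "'n::finite mindex"
proof -
  let ?M = "{J. J \<le> \<delta>}"
  have 1: "{Nonneg J \<delta>' |J \<delta>'. (J, \<delta>') \<in> lp_vars lp \<delta>} = (\<lambda>(J, \<delta>'). Nonneg J \<delta>') ` lp_vars lp \<delta>"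
    and 2: "{Upper J \<delta>' |J \<delta>'. (J, \<delta>') \<in> lp_vars lp \<delta>} = (\<lambda>(J, \<delta>'). Upper J \<delta>') ` lp_vars lp \<delta>"
    by auto
  have "finite {(\<delta>', r, J). \<delta>' < \<delta> \<and> mshift \<delta>' r 1 \<le> \<delta> \<and> J \<le> \<delta>'}"
  proof (rule finite_subset)
    show "{(\<delta>', r, J). \<delta>' < \<delta> \<and> mshift \<delta>' r 1 \<le> \<delta> \<and> J \<le> \<delta>'} \<subseteq> ?M \<times> UNIV \<times> ?M"
      by (auto intro: order_trans less_imp_le)
  qed (simp add: finite_mindex_le)
  then show ?thesis
    unfolding lp_rows_def Let_def 1 2 by (auto simp: finite_lp_vars finite_mindex_le)
qed

text \<open>The matrix \<open>bern_mat\<close> does convert the monomials to the Bernstein basis.\<close>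

lemma power_eq_sum_Bernstein:
  fixes x :: real
  assumes "i \<le> d"
  shows "x ^ i = (\<Sum>j\<le>d. (if i \<le> j then real (j choose i) / real (d choose i) else 0) * Bernstein d j x)"
proof -
  have "(\<Sum>j\<le>d. (if i \<le> j then real (j choose i) / real (d choose i) else 0) * Bernstein d j x)
      = (\<Sum>j=i..d. real (j choose i) / real (d choose i) * Bernstein d j x)"
    by (rule sum.mono_neutral_cong_right) auto
  also have "\<dots> = (\<Sum>j=i..d. x ^ i * Bernstein (d - i) (j - i) x)"
  proof (rule sum.cong)
    fix j assume j: "j \<in> {i..d}"
    have "real (d choose j) * real (j choose i) = real (d choose i) * real ((d - i) choose (j - i))"
      using choose_mult[of i j d] j by (metis atLeastAtMost_iff of_nat_mult)
    moreover have "real (d choose i) \<noteq> 0" using assms by simp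
    ultimately have 1: "real (j choose i) / real (d choose i) * real (d choose j) = real ((d - i) choose (j - i))"
      by (simp add: field_simps)
    have 2: "x ^ j = x ^ i * x ^ (j - i)" using j by (simp flip: power_add)
    have 3: "d - i - (j - i) = d - j" using j by auto
    have "real (j choose i) / real (d choose i) * Bernstein d j x
        = (real (j choose i) / real (d choose i) * real (d choose j)) * x ^ j * (1 - x) ^ (d - j)"
      by (simp only: Bernstein_def mult.assoc)
    also have "\<dots> = x ^ i * Bernstein (d - i) (j - i) x"
      unfolding 1 2 Bernstein_def 3 by (simp only: mult_ac)
    finally show "real (j choose i) / real (d choose i) * Bernstein d j x = x ^ i * Bernstein (d - i) (j - i) x" .
  qed simp
  also have "\<dots> = (\<Sum>k\<le>d - i. x ^ i * Bernstein (d - i) k x)"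
    by (rule sum.reindex_bij_witness[of _ "\<lambda>k. k + i" "\<lambda>j. j - i"]) (use assms in auto)
  also have "\<dots> = x ^ i"
    by (simp flip: sum_distrib_left)
  finally show ?thesis by simp
qed

lemma monomial_eq_sum_mBernstein:
  fixes \<delta> :: "'n::finite mindex"
  assumes "I \<le> \<delta>"
  shows "monomial I x = (\<Sum>J\<le>\<delta>. bern_coeff \<delta> J I * mBernstein J \<delta> x)"
proof -
  have "monomial I x = (\<Prod>l\<in>UNIV. \<Sum>j\<le>\<delta> l.
      (if I l \<le> j then real (j choose I l) / real (\<delta> l choose I l) else 0) * Bernstein (\<delta> l) j (x $ l))"
    unfolding monomial_def using assms
    by (intro prod.cong refl power_eq_sum_Bernstein) (auto simp: le_fun_def)
  also have "\<dots> = (\<Sum>J\<le>\<delta>. \<Prod>l\<in>UNIV.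
      (if I l \<le> J l then real (J l choose I l) / real (\<delta> l choose I l) else 0) * Bernstein (\<delta> l) (J l) (x $ l))"
    unfolding mindex_atMost_PiE by (rule prod_sum_PiE) auto
  also have "\<dots> = (\<Sum>J\<le>\<delta>. bern_coeff \<delta> J I * mBernstein J \<delta> x)"
  proof (rule sum.cong)
    fix J
    have "(\<Prod>l\<in>UNIV. if I l \<le> J l then real (J l choose I l) / real (\<delta> l choose I l) else 0)
        = bern_coeff \<delta> J I"
    proof (cases "I \<le> J")
      case True
      then show ?thesis
        by (simp add: bern_coeff_def mbinomial_def le_fun_def prod_dividef)
    next
      case False
      then obtain l where "\<not> I l \<le> J l" by (auto simp: le_fun_def)
      then have "(\<Prod>l\<in>UNIV. if I l \<le> J l then real (J l choose I l) / real (\<delta> l choose I l) else 0) = 0"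
        by (intro prod_zero) auto
      then show ?thesis using False by (simp add: bern_coeff_def)
    qed
    then show "(\<Prod>l\<in>UNIV. (if I l \<le> J l then real (J l choose I l) / real (\<delta> l choose I l) else 0)
        * Bernstein (\<delta> l) (J l) (x $ l)) = bern_coeff \<delta> J I * mBernstein J \<delta> x"
      by (simp add: prod.distrib mBernstein_def)
  qed simp
  finally show ?thesis .
qed

lemma monomial_eq_bern_mat:
  fixes \<delta> :: "'n::finite mindex"
  assumes "I \<le> \<delta>"
  shows "monomial I x = (\<Sum>(J, \<delta>')\<in>lp_vars lp \<delta>. bern_mat \<delta> I (J, \<delta>') * mBernstein J \<delta>' x)"
proof -
  have "(\<Sum>(J, \<delta>')\<in>lp_vars lp \<delta>. bern_mat \<delta> I (J, \<delta>') * mBernstein J \<delta>' x)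
      = (\<Sum>(J, \<delta>')\<in>(\<lambda>J. (J, \<delta>)) ` {..\<delta>}. bern_mat \<delta> I (J, \<delta>') * mBernstein J \<delta>' x)"
  proof (rule sum.mono_neutral_right)
    show "finite (lp_vars lp \<delta>)" by (rule finite_lp_vars)
  qed (auto simp: bern_mat_def lp_vars_def split: if_splits)
  also have "\<dots> = (\<Sum>J\<le>\<delta>. bern_coeff \<delta> J I * mBernstein J \<delta> x)"
    by (subst sum.reindex) (auto simp: inj_on_def bern_mat_def)
  finally show ?thesis
    using monomial_eq_sum_mBernstein[OF assms] by simp
qed

text \<open>The system \<open>A z \<le> b\<close> unfolds to the constraints of the three relaxations.\<close>

definition lp_feasible :: "relaxation \<Rightarrow> 'n::finite mindex \<Rightarrow> ('n bvar \<Rightarrow> real) \<Rightarrow> bool" where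
  "lp_feasible lp \<delta> z \<longleftrightarrow> (\<forall>i\<in>lp_rows lp \<delta>. (\<Sum>v\<in>lp_vars lp \<delta>. lp_mat i v * z v) \<le> lp_rhs i)"

lemma sum_of_bool_mult:
  fixes f :: "'a \<Rightarrow> real"
  assumes "finite V" "w \<in> V"
  shows "(\<Sum>v\<in>V. of_bool (v = w) * f v) = f w"
proof -
  have 1: "(\<Sum>v\<in>V. of_bool (v = w) * f v) = (\<Sum>v\<in>{w}. f v)"
  proof (rule sum.mono_neutral_cong_right)
    show "finite V" "{w} \<subseteq> V" using assms by simp_all
  qed simp_all
  show ?thesis unfolding 1 by simp
qed

lemma lp_row_sum:
  fixes \<delta> :: "'n::finite mindex" and z :: "'n bvar \<Rightarrow> real"
  assumes "\<delta>' = \<delta> \<or> lp = LP3 \<and> \<delta>' \<le> \<delta>"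
  shows "(\<Sum>v\<in>lp_vars lp \<delta>. of_bool (snd v = \<delta>') * z v) = (\<Sum>J\<le>\<delta>'. z (J, \<delta>'))"
proof -
  have "(\<Sum>v\<in>lp_vars lp \<delta>. of_bool (snd v = \<delta>') * z v) = (\<Sum>v\<in>(\<lambda>J. (J, \<delta>')) ` {..\<delta>'}. z v)"
  proof (rule sum.mono_neutral_cong_right)
    show "finite (lp_vars lp \<delta>)" by (rule finite_lp_vars)
  qed (use assms in \<open>auto simp: lp_vars_def split: if_splits\<close>)
  then show ?thesis by (simp add: sum.reindex inj_on_def)
qed

lemma lp_row_rec:
  fixes \<delta> :: "'n::finite mindex"
  assumes "J \<le> \<delta>'" "mshift \<delta>' r 1 \<le> \<delta>" "\<delta>' < \<delta>"
  shows "(\<Sum>v\<in>lp_vars LP3 \<delta>. rec_entry J \<delta>' r v * z v) =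
    z (J, \<delta>') - (real (\<delta>' r) + 1 - real (J r)) / (real (\<delta>' r) + 1) * z (J, mshift \<delta>' r 1)
     - (real (J r) + 1) / (real (\<delta>' r) + 1) * z (mshift J r 1, mshift \<delta>' r 1)"
proof -
  have "J \<le> mshift \<delta>' r 1" "mshift J r 1 \<le> mshift \<delta>' r 1"
    using assms(1) by (auto simp: le_fun_def mshift_def intro: le_SucI)
  then have v: "(J, \<delta>') \<in> lp_vars LP3 \<delta>" "(J, mshift \<delta>' r 1) \<in> lp_vars LP3 \<delta>"
    "(mshift J r 1, mshift \<delta>' r 1) \<in> lp_vars LP3 \<delta>"
    using assms by (auto simp: lp_vars_def)
  show ?thesis
    unfolding rec_entry_def left_diff_distrib sum_subtractf mult.assoc sum_distrib_left[symmetric]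
    by (simp only: sum_of_bool_mult[OF finite_lp_vars] v)
qed

lemma ball_row_family:
  "(\<forall>i\<in>{C J \<delta>' |J \<delta>'. (J, \<delta>') \<in> V}. Q i) \<longleftrightarrow> (\<forall>J \<delta>'. (J, \<delta>') \<in> V \<longrightarrow> Q (C J \<delta>'))"
  by blast

lemma lp_nonneg_rows:
  fixes \<delta> :: "'n::finite mindex"
  shows "(\<forall>i\<in>{Nonneg J \<delta>' |J \<delta>'. (J, \<delta>') \<in> lp_vars lp \<delta>}.
            (\<Sum>v\<in>lp_vars lp \<delta>. lp_mat i v * z v) \<le> lp_rhs i) \<longleftrightarrow>
         (\<forall>J \<delta>'. (J, \<delta>') \<in> lp_vars lp \<delta> \<longrightarrow> 0 \<le> z (J, \<delta>'))"
proof -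
  have "(\<Sum>v\<in>lp_vars lp \<delta>. lp_mat (Nonneg J \<delta>') v * z v) = - z (J, \<delta>')"
    if "(J, \<delta>') \<in> lp_vars lp \<delta>" for J \<delta>'
    unfolding lp_mat.simps minus_mult_left[symmetric] sum_negf
    by (simp only: sum_of_bool_mult[OF finite_lp_vars that])
  then have "(\<Sum>v\<in>lp_vars lp \<delta>. lp_mat (Nonneg J \<delta>') v * z v) \<le> lp_rhs (Nonneg J \<delta>') \<longleftrightarrow>
      0 \<le> z (J, \<delta>')" if "(J, \<delta>') \<in> lp_vars lp \<delta>" for J \<delta>'
    by (simp only: that lp_rhs.simps neg_le_0_iff_le)
  then show ?thesis unfolding ball_row_family by (simp only: cong: imp_cong)
qed

lemma lp_upper_rows:
  fixes \<delta> :: "'n::finite mindex"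
  shows "(\<forall>i\<in>{Upper J \<delta>' |J \<delta>'. (J, \<delta>') \<in> lp_vars lp \<delta>}.
            (\<Sum>v\<in>lp_vars lp \<delta>. lp_mat i v * z v) \<le> lp_rhs i) \<longleftrightarrow>
         (\<forall>J \<delta>'. (J, \<delta>') \<in> lp_vars lp \<delta> \<longrightarrow> z (J, \<delta>') \<le> mBernstein J \<delta>' (mquot J \<delta>'))"
proof -
  have "(\<Sum>v\<in>lp_vars lp \<delta>. lp_mat (Upper J \<delta>') v * z v) = z (J, \<delta>')"
    if "(J, \<delta>') \<in> lp_vars lp \<delta>" for J \<delta>'
    unfolding lp_mat.simps by (simp only: sum_of_bool_mult[OF finite_lp_vars that])
  then have "(\<Sum>v\<in>lp_vars lp \<delta>. lp_mat (Upper J \<delta>') v * z v) \<le> lp_rhs (Upper J \<delta>') \<longleftrightarrow>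
      z (J, \<delta>') \<le> mBernstein J \<delta>' (mquot J \<delta>')" if "(J, \<delta>') \<in> lp_vars lp \<delta>" for J \<delta>'
    by (simp only: that lp_rhs.simps neg_le_0_iff_le)
  then show ?thesis unfolding ball_row_family by (simp only: cong: imp_cong)
qed

lemma lp_sum_rows:
  fixes \<delta> :: "'n::finite mindex"
  assumes "D \<subseteq> (if lp = LP3 then {\<delta>'. \<delta>' \<le> \<delta>} else {\<delta>})"
  shows "(\<forall>i\<in>SumLe ` D \<union> SumGe ` D. (\<Sum>v\<in>lp_vars lp \<delta>. lp_mat i v * z v) \<le> lp_rhs i) \<longleftrightarrow>
         (\<forall>\<delta>'\<in>D. (\<Sum>J\<le>\<delta>'. z (J, \<delta>')) = 1)"
proof -
  have 1: "(\<Sum>v\<in>lp_vars lp \<delta>. lp_mat (SumLe \<delta>') v * z v) = (\<Sum>J\<le>\<delta>'. z (J, \<delta>'))"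
    if "\<delta>' \<in> D" for \<delta>'
    unfolding lp_mat.simps by (rule lp_row_sum) (use that assms in \<open>auto split: if_splits\<close>)
  have 2: "(\<Sum>v\<in>lp_vars lp \<delta>. lp_mat (SumGe \<delta>') v * z v) = - (\<Sum>v\<in>lp_vars lp \<delta>. lp_mat (SumLe \<delta>') v * z v)" for \<delta>'
    unfolding lp_mat.simps minus_mult_left[symmetric] sum_negf ..
  have "(\<forall>i\<in>SumLe ` D \<union> SumGe ` D. (\<Sum>v\<in>lp_vars lp \<delta>. lp_mat i v * z v) \<le> lp_rhs i) \<longleftrightarrow>
        (\<forall>\<delta>'\<in>D. (\<Sum>v\<in>lp_vars lp \<delta>. lp_mat (SumLe \<delta>') v * z v) = 1)"
    unfolding ball_Un ball_simps 2 lp_rhs.simps by (auto simp only: neg_le_iff_le intro: antisym)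
  then show ?thesis using 1 by (simp only: cong: ball_cong)
qed

lemma ball_rec_family:
  "(\<forall>i\<in>(\<Union>(\<delta>', r, J) \<in> {(\<delta>', r, J). A \<delta>' \<and> B \<delta>' r \<and> D \<delta>' J}. {RecLe J \<delta>' r, RecGe J \<delta>' r}). Q i)
   \<longleftrightarrow> (\<forall>\<delta>'. A \<delta>' \<longrightarrow> (\<forall>r. B \<delta>' r \<longrightarrow> (\<forall>J. D \<delta>' J \<longrightarrow> Q (RecLe J \<delta>' r) \<and> Q (RecGe J \<delta>' r))))"
  by fastforce

lemma lp_rec_rows:
  fixes \<delta> :: "'n::finite mindex"
  shows "(\<forall>i\<in>(\<Union>(\<delta>', r, J) \<in> {(\<delta>', r, J). \<delta>' < \<delta> \<and> mshift \<delta>' r 1 \<le> \<delta> \<and> J \<le> \<delta>'}.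
              {RecLe J \<delta>' r, RecGe J \<delta>' r}). (\<Sum>v\<in>lp_vars LP3 \<delta>. lp_mat i v * z v) \<le> lp_rhs i) \<longleftrightarrow>
    (\<forall>\<delta>'<\<delta>. \<forall>r. mshift \<delta>' r 1 \<le> \<delta> \<longrightarrow> (\<forall>J\<le>\<delta>'.
       z (J, \<delta>') = (real (\<delta>' r) + 1 - real (J r)) / (real (\<delta>' r) + 1) * z (J, mshift \<delta>' r 1)
         + (real (J r) + 1) / (real (\<delta>' r) + 1) * z (mshift J r 1, mshift \<delta>' r 1)))"
    (is "?L \<longleftrightarrow> ?R")
proof -
  let ?s = "\<lambda>J \<delta>' r. \<Sum>v\<in>lp_vars LP3 \<delta>. rec_entry J \<delta>' r v * z v"
  have Ge: "(\<Sum>v\<in>lp_vars LP3 \<delta>. lp_mat (RecGe J \<delta>' r) v * z v) = - ?s J \<delta>' r" for J \<delta>' r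
    unfolding lp_mat.simps minus_mult_left[symmetric] sum_negf ..
  have eq: "?s J \<delta>' r = 0 \<longleftrightarrow>
       z (J, \<delta>') = (real (\<delta>' r) + 1 - real (J r)) / (real (\<delta>' r) + 1) * z (J, mshift \<delta>' r 1)
         + (real (J r) + 1) / (real (\<delta>' r) + 1) * z (mshift J r 1, mshift \<delta>' r 1)"
    if "\<delta>' < \<delta>" "mshift \<delta>' r 1 \<le> \<delta>" "J \<le> \<delta>'" for J \<delta>' r
    unfolding lp_row_rec[OF that(3,2,1)] by (simp only: diff_diff_eq right_minus_eq)
  have "?L \<longleftrightarrow> (\<forall>\<delta>'<\<delta>. \<forall>r. mshift \<delta>' r 1 \<le> \<delta> \<longrightarrow> (\<forall>J\<le>\<delta>'. ?s J \<delta>' r \<le> 0 \<and> - ?s J \<delta>' r \<le> 0))"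
    unfolding ball_rec_family lp_rhs.simps Ge by (simp only: lp_mat.simps)
  also have "\<dots> \<longleftrightarrow> (\<forall>\<delta>'<\<delta>. \<forall>r. mshift \<delta>' r 1 \<le> \<delta> \<longrightarrow> (\<forall>J\<le>\<delta>'. ?s J \<delta>' r = 0))"
    by (simp only: neg_le_0_iff_le order_eq_iff[where 'a = real])
  also have "\<dots> \<longleftrightarrow> ?R"
    by (simp only: eq cong: imp_cong)
  finally show ?thesis .
qed

lemma lp_feasible_LP1:
  fixes \<delta> :: "'n::finite mindex"
  shows "lp_feasible LP1 \<delta> z \<longleftrightarrow> (\<forall>I\<le>\<delta>. 0 \<le> z (I, \<delta>)) \<and> (\<Sum>I\<le>\<delta>. z (I, \<delta>)) = 1"
proof -
  have rows: "lp_rows LP1 \<delta> = {Nonneg J \<delta>' |J \<delta>'. (J, \<delta>') \<in> lp_vars LP1 \<delta>}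
      \<union> (SumLe ` {\<delta>} \<union> SumGe ` {\<delta>})"
    by (simp add: lp_rows_def)
  have sum: "{\<delta>} \<subseteq> (if LP1 = LP3 then {\<delta>'. \<delta>' \<le> \<delta>} else {\<delta>})" by simp
  show ?thesis
    unfolding lp_feasible_def rows ball_Un[of "Collect _"] lp_nonneg_rows lp_sum_rows[OF sum]
    by (auto simp: lp_vars_def)
qed

lemma lp_feasible_LP2:
  fixes \<delta> :: "'n::finite mindex"
  shows "lp_feasible LP2 \<delta> z \<longleftrightarrow>
    (\<forall>I\<le>\<delta>. 0 \<le> z (I, \<delta>) \<and> z (I, \<delta>) \<le> mBernstein I \<delta> (mquot I \<delta>)) \<and> (\<Sum>I\<le>\<delta>. z (I, \<delta>)) = 1"
proof -
  have rows: "lp_rows LP2 \<delta> = {Nonneg J \<delta>' |J \<delta>'. (J, \<delta>') \<in> lp_vars LP2 \<delta>}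
      \<union> ({Upper J \<delta>' |J \<delta>'. (J, \<delta>') \<in> lp_vars LP2 \<delta>} \<union> (SumLe ` {\<delta>} \<union> SumGe ` {\<delta>}))"
    by (simp add: lp_rows_def Un_assoc)
  have sum: "{\<delta>} \<subseteq> (if LP2 = LP3 then {\<delta>'. \<delta>' \<le> \<delta>} else {\<delta>})" by simp
  show ?thesis
    unfolding lp_feasible_def rows ball_Un[of "Collect _"] lp_nonneg_rows lp_upper_rows
      lp_sum_rows[OF sum]
    by (auto simp: lp_vars_def)
qed

lemma lp_feasible_LP3:
  fixes \<delta> :: "'n::finite mindex"
  shows "lp_feasible LP3 \<delta> z \<longleftrightarrow>
    (\<forall>\<delta>'\<le>\<delta>. \<forall>J\<le>\<delta>'. 0 \<le> z (J, \<delta>') \<and> z (J, \<delta>') \<le> mBernstein J \<delta>' (mquot J \<delta>')) \<and>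
    (\<forall>\<delta>'\<le>\<delta>. (\<Sum>J\<le>\<delta>'. z (J, \<delta>')) = 1) \<and>
    (\<forall>\<delta>'<\<delta>. \<forall>r. mshift \<delta>' r 1 \<le> \<delta> \<longrightarrow> (\<forall>J\<le>\<delta>'.
       z (J, \<delta>') = (real (\<delta>' r) + 1 - real (J r)) / (real (\<delta>' r) + 1) * z (J, mshift \<delta>' r 1)
         + (real (J r) + 1) / (real (\<delta>' r) + 1) * z (mshift J r 1, mshift \<delta>' r 1)))"
    (is "_ \<longleftrightarrow> ?B \<and> ?S \<and> ?R")
proof -
  let ?D = "{\<delta>'. \<delta>' \<le> \<delta>}"
  let ?Q = "\<lambda>i. (\<Sum>v\<in>lp_vars LP3 \<delta>. lp_mat i v * z v) \<le> lp_rhs i"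
  let ?N = "{Nonneg J \<delta>' |J \<delta>'. (J, \<delta>') \<in> lp_vars LP3 \<delta>}"
  let ?U = "{Upper J \<delta>' |J \<delta>'. (J, \<delta>') \<in> lp_vars LP3 \<delta>}"
  let ?E = "\<Union>(\<delta>', r, J) \<in> {(\<delta>', r, J). \<delta>' < \<delta> \<and> mshift \<delta>' r 1 \<le> \<delta> \<and> J \<le> \<delta>'}.
      {RecLe J \<delta>' r, RecGe J \<delta>' r}"
  have sum: "?D \<subseteq> (if LP3 = LP3 then {\<delta>'. \<delta>' \<le> \<delta>} else {\<delta>})" by simp
  have "lp_rows LP3 \<delta> = ?N \<union> ?U \<union> (SumLe ` ?D \<union> SumGe ` ?D) \<union> ?E"
    by (simp only: lp_rows_def Let_def refl if_True relaxation.distinct if_False)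
  then have "lp_feasible LP3 \<delta> z \<longleftrightarrow> ((Ball ?N ?Q \<and> Ball ?U ?Q) \<and> Ball (SumLe ` ?D \<union> SumGe ` ?D) ?Q) \<and> Ball ?E ?Q"
    unfolding lp_feasible_def by (simp only: ball_Un[of ?N] ball_Un[of "?N \<union> ?U"] ball_Un[of _ ?E])
  moreover have "Ball ?N ?Q \<and> Ball ?U ?Q \<longleftrightarrow> ?B"
    unfolding lp_nonneg_rows lp_upper_rows by (auto simp: lp_vars_def)
  moreover have "Ball (SumLe ` ?D \<union> SumGe ` ?D) ?Q \<longleftrightarrow> ?S"
    unfolding lp_sum_rows[OF sum] by simp
  moreover have "Ball ?E ?Q \<longleftrightarrow> ?R"
    by (rule lp_rec_rows)
  ultimately show ?thesis by argo
qed

end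

theory Submission
  imports Defs
begin

text \<open>The equivalence is an affine Farkas lemma: the objective \<open>w z\<close>, where \<open>w = \<B>\<^sup>T c\<close>, is nonnegative
  on the polyhedron \<open>A z \<le> b\<close> iff \<open>- w\<close> is a nonnegative combination of the rows whose right-hand
  sides combine to a nonpositive number. The backward direction is weak duality. For the forward
  direction the system is homogenised by a variable \<open>t \<ge> 0\<close>: the homogeneous Farkas lemma
  (\<open>farkas_homogeneous\<close>), applied to the cone \<open>A z \<le> t b\<close>, \<open>t \<ge> 0\<close>, yields the multipliers
  (\<open>farkas_affine\<close>), provided that \<open>w z \<ge> 0\<close> holds on the whole cone. Where \<open>t > 0\<close> this follows by
  rescaling; the slice \<open>t = 0\<close> is the recession cone \<open>A z \<le> 0\<close>.

  For an inconsistent system a Farkas certificate with prescribed \<open>w\<close> can fail to exist in general, so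
  something specific to the relaxations has to enter. It is not consistency but boundedness: every
  variable is nonnegative and belongs to a group of variables with prescribed sum, so the recession
  cone contains only the zero vector (\<open>lp_recession_trivial\<close>) and the slice \<open>t = 0\<close> is harmless. This
  treats the three relaxations uniformly, without exhibiting a feasible point.\<close>

section \<open>Farkas lemmas over finite index sets\<close>

text \<open>The proof is Bartl's induction on the number of rows, which is purely algebraic. If the row \<open>p\<close>
  to be added cannot be dropped, there is a witness \<open>u\<close> that satisfies all the other inequalities and
  has \<open>g u > 0\<close>; then \<open>p u > 0\<close>, and one may normalise to \<open>p u = 1\<close>. The projection \<open>x - (p x) u\<close>
  onto the kernel of \<open>p\<close> removes the row \<open>p\<close>, and the induction hypothesis applies to the remaining
  rows composed with this projection. Undoing the projection gives \<open>p\<close> the multiplier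
  \<open>g u - (\<Sum>i. \<lambda>\<^sub>i (a\<^sub>i u))\<close>, which is nonnegative by the choice of \<open>u\<close>.\<close>

lemma farkas_homogeneous:
  fixes a :: "'r \<Rightarrow> 'v \<Rightarrow> real" and g :: "'v \<Rightarrow> real"
  assumes "finite R" "finite V"
    and "\<And>x. \<forall>i\<in>R. (\<Sum>v\<in>V. a i v * x v) \<le> 0 \<Longrightarrow> (\<Sum>v\<in>V. g v * x v) \<le> 0"
  shows "\<exists>l. (\<forall>i\<in>R. 0 \<le> l i) \<and> (\<forall>v\<in>V. g v = (\<Sum>i\<in>R. l i * a i v))"
  using assms(1,3)
proof (induction R arbitrary: a g rule: finite_induct)
  case empty
  \<comment> \<open>A functional that is nonpositive everywhere vanishes: test it on its own coefficient vector.\<close>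
  have "(\<Sum>v\<in>V. g v * g v) \<le> 0" by (rule empty) simp
  then have "(\<Sum>v\<in>V. g v * g v) = 0"
    by (intro antisym sum_nonneg) auto
  then have "\<forall>v\<in>V. g v = 0"
    using assms(2) by (simp add: sum_nonneg_eq_0_iff)
  then show ?case by simp
next
  case (insert k R)
  let ?dot = "\<lambda>f x. \<Sum>v\<in>V. f v * x v"
  show ?case
  proof (cases "\<forall>x. (\<forall>i\<in>R. ?dot (a i) x \<le> 0) \<longrightarrow> ?dot g x \<le> 0")
    case True
    then obtain l where l: "\<forall>i\<in>R. 0 \<le> l i" "\<forall>v\<in>V. g v = (\<Sum>i\<in>R. l i * a i v)"
      using insert.IH[of a g] by blast
    have "(\<Sum>i\<in>R. (l(k := 0)) i * a i v) = (\<Sum>i\<in>R. l i * a i v)" for v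
      using insert.hyps(2) by (intro sum.cong) auto
    then show ?thesis
      using l insert.hyps by (intro exI[of _ "l(k := 0)"]) auto
  next
    case False
    then obtain y where y: "\<forall>i\<in>R. ?dot (a i) y \<le> 0" "?dot g y > 0"
      by (auto simp: not_le)
    have pos: "?dot (a k) y > 0"
      using insert.prems[of y] y by (auto simp: not_le[symmetric])
    define u where "u = (\<lambda>v. y v / ?dot (a k) y)"
    have dot_u: "?dot f u = ?dot f y / ?dot (a k) y" for f
      by (simp add: u_def sum_divide_distrib)
    have u: "?dot (a k) u = 1" "\<And>i. i \<in> R \<Longrightarrow> ?dot (a i) u \<le> 0" "?dot g u > 0"
      unfolding dot_u using y pos by (auto simp: divide_le_0_iff)
    \<comment> \<open>\<open>proj f\<close> is the row vector of the functional \<open>f\<close> composed with the projection \<open>x - (a k x) u\<close>.\<close>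
    define proj where "proj f = (\<lambda>v. f v - ?dot f u * a k v)" for f
    have proj: "?dot (proj f) x = ?dot f (\<lambda>v. x v - ?dot (a k) x * u v)" for f x
    proof -
      have "?dot (proj f) x = ?dot f x - ?dot f u * ?dot (a k) x"
        by (simp add: proj_def left_diff_distrib sum_subtractf sum_distrib_left mult.assoc)
      also have "\<dots> = ?dot f (\<lambda>v. x v - ?dot (a k) x * u v)"
        by (simp add: right_diff_distrib sum_subtractf sum_distrib_right mult_ac)
      finally show ?thesis .
    qed
    have "\<exists>l. (\<forall>i\<in>R. 0 \<le> l i) \<and> (\<forall>v\<in>V. proj g v = (\<Sum>i\<in>R. l i * proj (a i) v))"
    proof (rule insert.IH)
      fix x assume x: "\<forall>i\<in>R. ?dot (proj (a i)) x \<le> 0"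
      have "?dot (proj (a k)) x = 0"
        by (simp add: proj_def u(1))
      with x show "?dot (proj g) x \<le> 0"
        unfolding proj by (intro insert.prems) auto
    qed
    then obtain l where l: "\<And>i. i \<in> R \<Longrightarrow> 0 \<le> l i"
      "\<And>v. v \<in> V \<Longrightarrow> proj g v = (\<Sum>i\<in>R. l i * proj (a i) v)" by blast
    define m where "m = ?dot g u - (\<Sum>i\<in>R. l i * ?dot (a i) u)"
    have "(\<Sum>i\<in>R. l i * ?dot (a i) u) \<le> 0"
      by (rule sum_nonpos) (rule mult_nonneg_nonpos[OF l(1) u(2)])
    then have m: "0 \<le> m" using u(3) by (simp add: m_def)
    have g: "g v = m * a k v + (\<Sum>i\<in>R. l i * a i v)" if "v \<in> V" for v
    proof -
      have "proj g v = (\<Sum>i\<in>R. l i * a i v) - (\<Sum>i\<in>R. l i * ?dot (a i) u) * a k v"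
        unfolding l(2)[OF that] unfolding proj_def
        by (simp add: right_diff_distrib sum_subtractf sum_distrib_right mult.assoc)
      then show ?thesis
        by (simp add: proj_def m_def algebra_simps)
    qed
    have "(\<Sum>i\<in>R. (l(k := m)) i * a i v) = (\<Sum>i\<in>R. l i * a i v)" for v
      using insert.hyps(2) by (intro sum.cong) auto
    then show ?thesis
      using l(1) m g insert.hyps by (intro exI[of _ "l(k := m)"]) auto
  qed
qed

text \<open>The index \<open>None\<close> stands for the homogenising variable \<open>t\<close> among the columns, and for the
  inequality \<open>- t \<le> 0\<close> among the rows. The multiplier of that row is \<open>- b\<^sup>T l\<close>, whence the sign
  condition.\<close>

lemma farkas_affine:
  fixes A :: "'r \<Rightarrow> 'v \<Rightarrow> real" and b :: "'r \<Rightarrow> real" and w :: "'v \<Rightarrow> real"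
  assumes fin: "finite R" "finite V"
    and feasible: "\<And>z. \<forall>i\<in>R. (\<Sum>v\<in>V. A i v * z v) \<le> b i \<Longrightarrow> 0 \<le> (\<Sum>v\<in>V. w v * z v)"
    and recession: "\<And>z. \<forall>i\<in>R. (\<Sum>v\<in>V. A i v * z v) \<le> 0 \<Longrightarrow> 0 \<le> (\<Sum>v\<in>V. w v * z v)"
  shows "\<exists>l. (\<forall>i\<in>R. 0 \<le> l i) \<and> (\<forall>v\<in>V. (\<Sum>i\<in>R. A i v * l i) = - w v) \<and> (\<Sum>i\<in>R. b i * l i) \<le> 0"
proof -
  define R' where "R' = insert None (Some ` R)"
  define V' where "V' = insert None (Some ` V)"
  define a where "a i v = (case (i, v) of (Some i, Some v) \<Rightarrow> A i v | (Some i, None) \<Rightarrow> - b i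
      | (None, Some v) \<Rightarrow> 0 | (None, None) \<Rightarrow> - 1)" for i v
  define g where "g v = (case v of Some v \<Rightarrow> - w v | None \<Rightarrow> 0)" for v
  have sum_R': "(\<Sum>i\<in>R'. f i) = f None + (\<Sum>i\<in>R. f (Some i))" for f :: "'r option \<Rightarrow> real"
    using fin(1) by (simp add: R'_def sum.reindex)
  have sum_V': "(\<Sum>v\<in>V'. f v) = f None + (\<Sum>v\<in>V. f (Some v))" for f :: "'v option \<Rightarrow> real"
    using fin(2) by (simp add: V'_def sum.reindex)
  have "\<exists>l. (\<forall>i\<in>R'. 0 \<le> l i) \<and> (\<forall>v\<in>V'. g v = (\<Sum>i\<in>R'. l i * a i v))"
  proof (rule farkas_homogeneous)
    show "finite R'" "finite V'" using fin by (simp_all add: R'_def V'_def)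
  next
    fix x assume x: "\<forall>i\<in>R'. (\<Sum>v\<in>V'. a i v * x v) \<le> 0"
    define t where "t = x None"
    define z where "z v = x (Some v)" for v
    have t: "0 \<le> t"
      using x by (simp add: R'_def sum_V' a_def t_def)
    have z: "\<forall>i\<in>R. (\<Sum>v\<in>V. A i v * z v) \<le> b i * t"
      using x by (simp add: R'_def sum_V' a_def t_def z_def)
    have "0 \<le> (\<Sum>v\<in>V. w v * z v)"
    proof (cases "t = 0")
      case True
      with z show ?thesis by (intro recession) simp
    next
      case False
      with t have t: "0 < t" by simp
      have scale: "(\<Sum>v\<in>V. f v * (z v / t)) = (\<Sum>v\<in>V. f v * z v) / t" for f
        by (simp add: sum_divide_distrib)
      have "0 \<le> (\<Sum>v\<in>V. w v * (z v / t))"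
        by (rule feasible) (use z t in \<open>simp only: scale pos_divide_le_eq\<close>)
      with t show ?thesis unfolding scale by (simp add: zero_le_divide_iff)
    qed
    then show "(\<Sum>v\<in>V'. g v * x v) \<le> 0"
      by (simp add: sum_V' g_def z_def sum_negf)
  qed
  then obtain l where l: "\<forall>i\<in>R'. 0 \<le> l i" "\<forall>v\<in>V'. g v = (\<Sum>i\<in>R'. l i * a i v)" by blast
  have "l None \<ge> 0" "\<forall>i\<in>R. 0 \<le> l (Some i)"
    using l(1) by (simp_all add: R'_def)
  moreover have "(\<Sum>i\<in>R. b i * l (Some i)) = - l None"
    using l(2) by (simp add: V'_def sum_R' g_def a_def sum_negf mult.commute)
  moreover have "\<forall>v\<in>V. (\<Sum>i\<in>R. A i v * l (Some i)) = - w v"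
    using l(2) by (simp add: V'_def sum_R' g_def a_def mult.commute)
  ultimately show ?thesis by (intro exI[of _ "\<lambda>i. l (Some i)"]) auto
qed

lemma farkas_weak_duality:
  fixes A :: "'r \<Rightarrow> 'v \<Rightarrow> real" and b :: "'r \<Rightarrow> real" and w :: "'v \<Rightarrow> real"
  assumes l: "\<forall>i\<in>R. 0 \<le> l i" "\<forall>v\<in>V. (\<Sum>i\<in>R. A i v * l i) = - w v" "(\<Sum>i\<in>R. b i * l i) \<le> 0"
    and z: "\<forall>i\<in>R. (\<Sum>v\<in>V. A i v * z v) \<le> b i"
  shows "0 \<le> (\<Sum>v\<in>V. w v * z v)"
proof -
  have "- (\<Sum>v\<in>V. w v * z v) = (\<Sum>v\<in>V. (\<Sum>i\<in>R. A i v * l i) * z v)"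
    using l(2) by (simp add: sum_negf)
  also have "\<dots> = (\<Sum>i\<in>R. (\<Sum>v\<in>V. A i v * z v) * l i)"
    by (subst (2) sum_distrib_right, subst sum_distrib_right, subst sum.swap) (simp add: mult_ac)
  also have "\<dots> \<le> (\<Sum>i\<in>R. b i * l i)"
    using l(1) z by (intro sum_mono mult_right_mono) auto
  finally show ?thesis using l(3) by simp
qed

section \<open>The recession cone of the relaxations\<close>

text \<open>With zero right-hand sides, the variables of one multidegree \<open>\<delta>'\<close> are nonnegative and have a
  nonpositive sum, so all of them vanish. This reaches every variable: for \<open>LP1\<close> and \<open>LP2\<close> the only
  multidegree is \<open>\<delta>\<close>, and \<open>LP3\<close> has a sum row for each \<open>\<delta>' \<le> \<delta>\<close>.\<close>

lemma lp_recession_trivial: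
  fixes \<delta> :: "'n::finite mindex"
  assumes z: "\<forall>i\<in>lp_rows lp \<delta>. (\<Sum>v\<in>lp_vars lp \<delta>. lp_mat i v * z v) \<le> 0"
    and v: "v \<in> lp_vars lp \<delta>"
  shows "z v = 0"
proof -
  obtain J \<delta>' where [simp]: "v = (J, \<delta>')" by (cases v)
  have nonneg: "0 \<le> z (K, \<epsilon>)" if "(K, \<epsilon>) \<in> lp_vars lp \<delta>" for K \<epsilon>
  proof -
    have "Nonneg K \<epsilon> \<in> lp_rows lp \<delta>"
      using that by (simp add: lp_rows_def)
    then have "(\<Sum>v\<in>lp_vars lp \<delta>. - (of_bool (v = (K, \<epsilon>)) * z v)) \<le> 0"
      using z by fastforce
    then show ?thesis
      by (simp only: sum_negf sum_of_bool_mult[OF finite_lp_vars that] neg_le_0_iff_le)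
  qed
  have deg: "\<delta>' = \<delta> \<or> lp = LP3 \<and> \<delta>' \<le> \<delta>" and J: "J \<le> \<delta>'"
    using v by (auto simp: lp_vars_def split: if_splits)
  have "SumLe \<delta>' \<in> lp_rows lp \<delta>"
    using deg by (auto simp: lp_rows_def Let_def)
  then have le: "(\<Sum>K\<le>\<delta>'. z (K, \<delta>')) \<le> 0"
    using z lp_row_sum[OF deg, of z] by fastforce
  have pos: "0 \<le> z (K, \<delta>')" if "K \<le> \<delta>'" for K
    using that deg by (intro nonneg) (auto simp: lp_vars_def)
  have "z (J, \<delta>') \<le> (\<Sum>K\<le>\<delta>'. z (K, \<delta>'))"
    using J pos finite_mindex_le[of \<delta>'] by (intro member_le_sum) (auto simp: atMost_def)
  with le pos[OF J] show ?thesis by simp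
qed

theorem lemma5p1:
  fixes \<delta> :: "'n::finite mindex"
    and lp :: relaxation
    and P :: "real ^ 'n \<Rightarrow> ('n mindex \<Rightarrow> real) \<Rightarrow> real"
    and c :: "'n mindex \<Rightarrow> real"
  assumes "\<forall>x a. P x a = (\<Sum>I\<le>\<delta>. a I * monomial I x)"
  shows "(\<forall>z :: 'n bvar \<Rightarrow> real.
            (\<forall>i\<in>lp_rows lp \<delta>. (\<Sum>v\<in>lp_vars lp \<delta>. lp_mat i v * z v) \<le> lp_rhs i) \<longrightarrow>
            0 \<le> (\<Sum>I\<le>\<delta>. c I * (\<Sum>v\<in>lp_vars lp \<delta>. bern_mat \<delta> I v * z v)))
     \<longleftrightarrow>
         (\<exists>lam :: 'n lp_row \<Rightarrow> real.
            (\<forall>i\<in>lp_rows lp \<delta>. 0 \<le> lam i) \<and>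
            (\<forall>v\<in>lp_vars lp \<delta>.
               (\<Sum>i\<in>lp_rows lp \<delta>. lp_mat i v * lam i) = - (\<Sum>I\<le>\<delta>. bern_mat \<delta> I v * c I)) \<and>
            (\<Sum>i\<in>lp_rows lp \<delta>. lp_rhs i * lam i) \<le> 0)"
proof -
  define w where "w v = (\<Sum>I\<le>\<delta>. bern_mat \<delta> I v * c I)" for v
  have objective: "(\<Sum>I\<le>\<delta>. c I * (\<Sum>v\<in>lp_vars lp \<delta>. bern_mat \<delta> I v * z v))
      = (\<Sum>v\<in>lp_vars lp \<delta>. w v * z v)" for z
    unfolding w_def sum_distrib_left sum_distrib_right
    by (subst sum.swap) (simp only: mult_ac)
  show ?thesis
    unfolding objective w_def[symmetric]
  proof (intro iffI allI impI)
    assume nonneg: "\<forall>z. (\<forall>i\<in>lp_rows lp \<delta>. (\<Sum>v\<in>lp_vars lp \<delta>. lp_mat i v * z v) \<le> lp_rhs i) \<longrightarrow>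
        0 \<le> (\<Sum>v\<in>lp_vars lp \<delta>. w v * z v)"
    show "\<exists>lam. (\<forall>i\<in>lp_rows lp \<delta>. 0 \<le> lam i) \<and>
        (\<forall>v\<in>lp_vars lp \<delta>. (\<Sum>i\<in>lp_rows lp \<delta>. lp_mat i v * lam i) = - w v) \<and>
        (\<Sum>i\<in>lp_rows lp \<delta>. lp_rhs i * lam i) \<le> 0"
    proof (rule farkas_affine[OF finite_lp_rows finite_lp_vars])
      fix z assume "\<forall>i\<in>lp_rows lp \<delta>. (\<Sum>v\<in>lp_vars lp \<delta>. lp_mat i v * z v) \<le> 0"
      then show "0 \<le> (\<Sum>v\<in>lp_vars lp \<delta>. w v * z v)"
        by (intro sum_nonneg) (simp add: lp_recession_trivial[of lp \<delta> z])
    qed (use nonneg in blast)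
  next
    fix z
    assume "\<exists>lam. (\<forall>i\<in>lp_rows lp \<delta>. 0 \<le> lam i) \<and>
        (\<forall>v\<in>lp_vars lp \<delta>. (\<Sum>i\<in>lp_rows lp \<delta>. lp_mat i v * lam i) = - w v) \<and>
        (\<Sum>i\<in>lp_rows lp \<delta>. lp_rhs i * lam i) \<le> 0"
      and "\<forall>i\<in>lp_rows lp \<delta>. (\<Sum>v\<in>lp_vars lp \<delta>. lp_mat i v * z v) \<le> lp_rhs i"
    then show "0 \<le> (\<Sum>v\<in>lp_vars lp \<delta>. w v * z v)"
      using farkas_weak_duality by blast
  qed
qed

end
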